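(* The flowmap $\varphi$ of the stochastic differential equation has the representation $$\varphi=(\mu\otimes\bar\mu)(\mathrm{Id})=(\mu\otimes\bar\mu)\Big(\sum_{w^0}w^0\otimes\overline w^0\Big),$$ where the sum is over all words $w^0\in(\mathbb A^0)^*$ (equivalently over all $w\in\mathbb A^*$) and $\mathrm{Id}=\sum_{w\in\mathbb A^*}w\otimes\overline w$ is the identity map of $\mathbb R\langle\mathbb A\rangle$.
   Context: Setting. $0\le d\le\ell$, $N\ge1$. $V_0,\dots,V_\ell:\mathbb R^N\to\mathbb R^N$ are analytic vector fields. $W^1,\dots,W^d$ are Wiener processes and $J^{d+1},\dots,J^\ell$ are purely discontinuous martingale Lévy processes, all independent, with moments of all orders; the SDE is $Y_t=Y_0+\int_0^tV_0(Y_{s-})ds+\sum_{i=1}^d\int_0^tV_i(Y_{s-})dW^i_s+\sum_{i=d+1}^\ell\int_0^tV_i(Y_{s-})dJ^i_s$, and the flowmap acts on analytic $f$ by $(\varphi_t\circ f)(Y_0)=f(Y_t)$. Alphabet. $\mathbb A=\{0,1,\dots,\ell\}\cup\{i^{(2)}:1\le i\le d\}\cup\{i^{(m)}:d+1\le i\le\ell,\ m\ge2\}$, with $i^{(1)}:=i$; $\mathbb A^*$ is the set of words, $\mathbb R\langle\mathbb A\rangle$ its linear span. Grading: $g(0)=1$, $g(i^{(k)})=k$ for $1\le i\le\ell$, additive on words (finitely many words in each degree). Bracket product: the commutative associative bilinear product on the span of $\mathbb A$ with $[0,a]=0$ for all letters $a$; $[i,i]=i^{(2)}$, $[i,i^{(2)}]=0$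 for $1\le i\le d$; $[i^{(p)},i^{(q)}]=i^{(p+q)}$ for $d+1\le i\le\ell$; $[i^{(p)},j^{(q)}]=0$ for $i\neq j$. Iterated: $[a_1,\dots,a_n]=[a_1,[a_2,\dots,a_n]]$. Integrals. $I_0(t)=t$; $I_i=W^i$ ($1\le i\le d$); $I_i=J^i$ ($d<i\le\ell$); $I_{i^{(2)}}=[W^i,W^i]$ ($1\le i\le d$, quadratic variation); $I_{i^{(m)}}(t)=\sum_{0\le s\le t}(\Delta J^i_s)^m$ ($d<i\le\ell$, $m\ge2$). For words, $I_{\mathbf 1}=1$ (empty word) and $I_{wa}(t)=\int_0^tI_w(s-)\,dI_a(s)$. $\mu$ is the linear map with $\mu(w)=I_w$. Differential operators. For $i^{(m)}\in\mathbb A$, $D_{i^{(m)}}=\frac1{m!}\sum_{j_1,\dots,j_m=1}^NV_i^{j_1}\cdots V_i^{j_m}\partial^m_{j_1\cdots j_m}$; $D_{a_1\cdots a_n}=D_{a_1}\circ\cdots\circ D_{a_n}$. On a copy $\overline{\mathbb A}=\{\overline a\}$ of the alphabet, $\bar\mu$ is the unital algebra morphism from the free associative algebra $\mathbb R\langle\overline{\mathbb A}\rangle$ to differential operators with $\bar\mu(\overline a)=D_a$. Flowmap expansion. By the stochastic Taylor expansion, $\varphi_t=\sum_{w\in\mathbb A^*}I_w(t)D_w$, understood as a formal series graded by $g$; identities between such series are understood degree by degree (in each degree the sums are finite). New bases. $\overline a^0:=\sum_{n\ge1}\frac{(-1)^{n-1}}n\sum_{[a_1,\dots,a_n]=a}\overline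 a_1\cdots\overline a_n$ (sum over letters $a_i\in\mathbb A$); for $w=a_1\cdots a_n$, $\overline w^0:=\overline a^0_1\cdots\overline a^0_n$. The $\overline w^0$ form a basis of $\mathbb R\langle\overline{\mathbb A}\rangle$, and $(\mathbb A^0)^*=\{w^0:w\in\mathbb A^*\}$ denotes the dual basis of $\mathbb R\langle\mathbb A\rangle$ for the pairing $\langle w,\overline{w'}\rangle=\delta_{w=w'}$. A tensor $x\otimes\overline y$ is viewed as the linear endomorphism $z\mapsto\langle z,\overline y\rangle x$ of $\mathbb R\langle\mathbb A\rangle$. *)

theory Defs
  imports "HOL-Probability.Probability" "HOL-Library.Poly_Mapping"
begin

section \<open>Words and the free associative algebra\<close>

text \<open>Lists are made a monoid under concatenation, so that the convolution product of
  \<open>Poly_Mapping\<close> turns \<open>'a list \<Rightarrow>\<^sub>0 real\<close> into the free associative unital algebra,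
  with the empty word as unit.\<close>

instantiation list :: (type) monoid_add
begin

definition zero_list :: "'a list" where "zero_list = []"

definition plus_list :: "'a list \<Rightarrow> 'a list \<Rightarrow> 'a list" where "plus_list u v = u @ v"

instance by standard (simp_all add: zero_list_def plus_list_def)

end

text \<open>The pair \<open>(i, m)\<close> stands for the letter \<open>i\<^sup>(\<^sup>m\<^sup>)\<close>; in particular \<open>(i, 1)\<close> is \<open>i\<close>, and \<open>(0, 1)\<close>
  is the letter \<open>0\<close>.\<close>

type_synonym letter = "nat \<times> nat"

type_synonym word_poly = "letter list \<Rightarrow>\<^sub>0 real"

definition alphabet :: "nat \<Rightarrow> nat \<Rightarrow> letter set" where
  "alphabet d l = {(i, 1) | i. i \<le> l} \<union> {(i, 2) | i. 1 \<le> i \<and> i \<le> d}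
     \<union> {(i, m) | i m. d + 1 \<le> i \<and> i \<le> l \<and> 2 \<le> m}"

abbreviation words :: "nat \<Rightarrow> nat \<Rightarrow> letter list set" where
  "words d l \<equiv> lists (alphabet d l)"

text \<open>\<open>\<real>\<langle>\<A>\<rangle>\<close>; the copy on the barred alphabet is represented by the same set.\<close>

definition word_space :: "nat \<Rightarrow> nat \<Rightarrow> word_poly set" where
  "word_space d l = {p. Poly_Mapping.keys p \<subseteq> words d l}"

definition scale :: "real \<Rightarrow> word_poly \<Rightarrow> word_poly" where
  "scale c p = Poly_Mapping.map (\<lambda>x. c * x) p"

definition of_word :: "letter list \<Rightarrow> word_poly" where
  "of_word w = Poly_Mapping.single w 1"

fun letter_grade :: "letter \<Rightarrow> nat" where
  "letter_grade (i, k) = (if i = 0 then 1 else k)"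

definition grade :: "letter list \<Rightarrow> nat" where
  "grade w = sum_list (map letter_grade w)"

text \<open>The bracket product of two letters is a letter or \<open>0\<close>; \<open>None\<close> stands for \<open>0\<close>. The products
  not listed among the defining relations for \<open>1 \<le> i \<le> d\<close>, namely \<open>[i\<^sup>(\<^sup>2\<^sup>), i\<^sup>(\<^sup>2\<^sup>)]\<close>, vanish by
  associativity.\<close>

fun bracket :: "nat \<Rightarrow> letter \<Rightarrow> letter \<Rightarrow> letter option" where
  "bracket d (i, p) (j, q) =
     (if i = j \<and> (d < i \<or> 1 \<le> i \<and> i \<le> d \<and> p = 1 \<and> q = 1) then Some (i, p + q) else None)"

fun brackets :: "nat \<Rightarrow> letter list \<Rightarrow> letter option" where
  "brackets d [] = None"
| "brackets d [a] = Some a"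
| "brackets d (a # b # w) = Option.bind (brackets d (b # w)) (bracket d a)"

section \<open>The new bases\<close>

text \<open>The sum is finite: \<open>brackets d w = Some a\<close> forces \<open>grade w = letter_grade a\<close>.\<close>

definition bar0_letter :: "nat \<Rightarrow> nat \<Rightarrow> letter \<Rightarrow> word_poly" where
  "bar0_letter d l a =
     (\<Sum>w | w \<in> words d l \<and> brackets d w = Some a.
        scale ((-1) ^ (length w - 1) / real (length w)) (of_word w))"

definition bar0 :: "nat \<Rightarrow> nat \<Rightarrow> letter list \<Rightarrow> word_poly" where
  "bar0 d l w = prod_list (map (bar0_letter d l) w)"

definition pairing :: "word_poly \<Rightarrow> word_poly \<Rightarrow> real" where
  "pairing p q = (\<Sum>w\<in>Poly_Mapping.keys p. Poly_Mapping.lookup p w * Poly_Mapping.lookup q w)"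

text \<open>The element \<open>w\<^sup>0\<close> of the dual basis. It exists and is unique because \<open>bar0 d l u\<close> is the
  word \<open>u\<close> plus a combination of strictly longer words of the same grade, and there are only
  finitely many words of each grade.\<close>

definition dual0 :: "nat \<Rightarrow> nat \<Rightarrow> letter list \<Rightarrow> word_poly" where
  "dual0 d l w = (THE p. p \<in> word_space d l \<and>
     (\<forall>u\<in>words d l. pairing p (bar0 d l u) = (if u = w then 1 else 0)))"

text \<open>The sum of the tensors \<open>x\<^sub>w \<otimes> y\<^sub>w\<close> over all words \<open>w\<close>, as an endomorphism of \<open>\<real>\<langle>\<A>\<rangle>\<close>.\<close>

definition tensor_sum ::
  "nat \<Rightarrow> nat \<Rightarrow> (letter list \<Rightarrow> word_poly) \<Rightarrow> (letter list \<Rightarrow> word_poly) \<Rightarrow> word_poly \<Rightarrow> word_poly"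
where
  "tensor_sum d l x y z =
     (\<Sum>w | w \<in> words d l \<and> pairing z (y w) \<noteq> 0. scale (pairing z (y w)) (x w))"

definition Id_tensor :: "nat \<Rightarrow> nat \<Rightarrow> word_poly \<Rightarrow> word_poly" where
  "Id_tensor d l = tensor_sum d l of_word of_word"

section \<open>Analytic functions and differential operators\<close>

definition real_analytic :: "(real ^ 'n \<Rightarrow> 'b::real_normed_vector) \<Rightarrow> bool" where
  "real_analytic f \<longleftrightarrow> (\<forall>x. \<exists>r>0. \<exists>c :: ('n \<Rightarrow> nat) \<Rightarrow> 'b. \<forall>y. (\<forall>i. \<bar>y $ i - x $ i\<bar> < r) \<longrightarrow>
     ((\<lambda>k. (\<Prod>i\<in>UNIV. (y $ i - x $ i) ^ k i) *\<^sub>R c k) has_sum f y) UNIV)"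

definition partial :: "'n \<Rightarrow> (real ^ 'n \<Rightarrow> real) \<Rightarrow> real ^ 'n \<Rightarrow> real" where
  "partial j f x = deriv (\<lambda>h. f (x + h *\<^sub>R axis j 1)) 0"

text \<open>For the letter \<open>0 = (0, 1)\<close> this is \<open>D\<^sub>0 = \<Sum>\<^sub>j V\<^sub>0\<^sup>j \<partial>\<^sub>j\<close>.\<close>

fun diff_op :: "(nat \<Rightarrow> real ^ 'n \<Rightarrow> real ^ 'n) \<Rightarrow> letter
    \<Rightarrow> (real ^ 'n \<Rightarrow> real) \<Rightarrow> real ^ 'n \<Rightarrow> real" where
  "diff_op V (i, m) f x =
     1 / fact m * (\<Sum>js | length js = m. (\<Prod>j\<leftarrow>js. V i x $ j) * foldr partial js f x)"

definition word_op :: "(nat \<Rightarrow> real ^ 'n \<Rightarrow> real ^ 'n) \<Rightarrow> letter list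
    \<Rightarrow> (real ^ 'n \<Rightarrow> real) \<Rightarrow> real ^ 'n \<Rightarrow> real" where
  "word_op V w = foldr (\<lambda>a D. diff_op V a \<circ> D) w id"

definition mu_bar :: "(nat \<Rightarrow> real ^ 'n \<Rightarrow> real ^ 'n) \<Rightarrow> word_poly
    \<Rightarrow> (real ^ 'n \<Rightarrow> real) \<Rightarrow> real ^ 'n \<Rightarrow> real" where
  "mu_bar V p f x = (\<Sum>w\<in>Poly_Mapping.keys p. Poly_Mapping.lookup p w * word_op V w f x)"

section \<open>Driving processes\<close>

text \<open>Processes are indexed by the reals; only nonnegative times are meaningful.\<close>

type_synonym 'a process = "real \<Rightarrow> 'a \<Rightarrow> real"

definition cadlag :: "(real \<Rightarrow> real) \<Rightarrow> bool" where
  "cadlag x \<longleftrightarrow> (\<forall>t\<ge>0. continuous (at_right t) x) \<and> (\<forall>t>0. \<exists>L. (x \<longlongrightarrow> L) (at_left t))"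

definition jump :: "'a process \<Rightarrow> 'a process" where
  "jump X t \<omega> = (if t \<le> 0 then 0 else X t \<omega> - Lim (at_left t) (\<lambda>s. X s \<omega>))"

text \<open>The filtration generated by the processes \<open>X i\<close>, \<open>i \<in> K\<close>, augmented by the null sets.\<close>

definition history :: "'a measure \<Rightarrow> nat set \<Rightarrow> (nat \<Rightarrow> 'a process) \<Rightarrow> real \<Rightarrow> 'a measure" where
  "history M K X t = sigma (space M)
     ({X i s -` B \<inter> space M | i s B. i \<in> K \<and> 0 \<le> s \<and> s \<le> t \<and> B \<in> sets borel} \<union> null_sets M)"

definition levy_process :: "'a measure \<Rightarrow> 'a process \<Rightarrow> bool" where
  "levy_process M X \<longleftrightarrow>
     (\<forall>t\<ge>0. X t \<in> borel_measurable M) \<and>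
     (AE \<omega> in M. X 0 \<omega> = 0) \<and>
     (AE \<omega> in M. cadlag (\<lambda>t. X t \<omega>)) \<and>
     (\<forall>(n::nat) p. 0 \<le> p 0 \<and> (\<forall>k<n. p k \<le> p (Suc k)) \<longrightarrow>
        prob_space.indep_vars M (\<lambda>_. borel) (\<lambda>k \<omega>. X (p (Suc k)) \<omega> - X (p k) \<omega>) {..<n}) \<and>
     (\<forall>s t. 0 \<le> s \<and> s \<le> t \<longrightarrow>
        distr M borel (\<lambda>\<omega>. X t \<omega> - X s \<omega>) = distr M borel (X (t - s)))"

definition wiener_process :: "'a measure \<Rightarrow> 'a process \<Rightarrow> bool" where
  "wiener_process M X \<longleftrightarrow>
     levy_process M X \<and>
     (AE \<omega> in M. continuous_on {0..} (\<lambda>t. X t \<omega>)) \<and>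
     (\<forall>s t. 0 \<le> s \<and> s < t \<longrightarrow>
        distributed M lborel (\<lambda>\<omega>. X t \<omega> - X s \<omega>) (normal_density 0 (sqrt (t - s))))"

definition martingale :: "'a measure \<Rightarrow> (real \<Rightarrow> 'a measure) \<Rightarrow> 'a process \<Rightarrow> bool" where
  "martingale M F X \<longleftrightarrow>
     (\<forall>t\<ge>0. X t \<in> borel_measurable (F t) \<and> integrable M (X t)) \<and>
     (\<forall>s t. 0 \<le> s \<and> s \<le> t \<longrightarrow> (AE \<omega> in M. real_cond_exp M (F s) (X t) \<omega> = X s \<omega>))"

text \<open>Purely discontinuous square integrable martingales: those null at \<open>0\<close> and (strongly)
  orthogonal to every continuous square integrable martingale.\<close>

definition purely_discontinuous_martingale ::
  "'a measure \<Rightarrow> (real \<Rightarrow> 'a measure) \<Rightarrow> 'a process \<Rightarrow> bool" where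
  "purely_discontinuous_martingale M F X \<longleftrightarrow>
     martingale M F X \<and>
     (\<forall>t\<ge>0. integrable M (\<lambda>\<omega>. (X t \<omega>)\<^sup>2)) \<and>
     (AE \<omega> in M. X 0 \<omega> = 0) \<and>
     (\<forall>N. martingale M F N \<and> (\<forall>t\<ge>0. integrable M (\<lambda>\<omega>. (N t \<omega>)\<^sup>2)) \<and>
          (\<forall>\<omega>\<in>space M. continuous_on {0..} (\<lambda>t. N t \<omega>)) \<longrightarrow>
          martingale M F (\<lambda>t \<omega>. X t \<omega> * N t \<omega>))"

definition driver :: "nat \<Rightarrow> (nat \<Rightarrow> 'a process) \<Rightarrow> (nat \<Rightarrow> 'a process) \<Rightarrow> nat \<Rightarrow> 'a process" where
  "driver d W J i t \<omega> = (if i = 0 then t else if i \<le> d then W i t \<omega> else J i t \<omega>)"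

text \<open>Independence of the processes is independence of the path-valued random variables.\<close>

definition driving_processes ::
  "'a measure \<Rightarrow> nat \<Rightarrow> nat \<Rightarrow> (nat \<Rightarrow> 'a process) \<Rightarrow> (nat \<Rightarrow> 'a process) \<Rightarrow> bool" where
  "driving_processes M d l W J \<longleftrightarrow>
     (\<forall>i\<in>{1..d}. wiener_process M (W i)) \<and>
     (\<forall>i\<in>{d+1..l}. levy_process M (J i) \<and>
        purely_discontinuous_martingale M (history M {i} J) (J i)) \<and>
     prob_space.indep_vars M (\<lambda>_. PiM {0..} (\<lambda>_. borel))
       (\<lambda>i \<omega>. \<lambda>t\<in>{0..}. driver d W J i t \<omega>) {1..l} \<and>
     (\<forall>i\<in>{1..l}. \<forall>t\<ge>0. \<forall>k::nat. integrable M (\<lambda>\<omega>. \<bar>driver d W J i t \<omega>\<bar> ^ k))"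

section \<open>Stochastic integrals\<close>

text \<open>Convergence in probability of \<open>S n p\<close> to \<open>Z\<close> as the mesh of the partition
  \<open>0 = p 0 \<le> \<dots> \<le> p n = t\<close> tends to \<open>0\<close>.\<close>

definition mesh_limit_in_prob ::
  "'a measure \<Rightarrow> real \<Rightarrow> (nat \<Rightarrow> (nat \<Rightarrow> real) \<Rightarrow> 'a \<Rightarrow> real) \<Rightarrow> ('a \<Rightarrow> real) \<Rightarrow> bool" where
  "mesh_limit_in_prob M t S Z \<longleftrightarrow>
     (\<forall>\<epsilon>>0. \<exists>\<delta>>0. \<forall>n p. p 0 = 0 \<and> p n = t \<and> (\<forall>k<n. p k \<le> p (Suc k) \<and> p (Suc k) - p k < \<delta>) \<longrightarrow>
        measure M {\<omega>\<in>space M. \<bar>S n p \<omega> - Z \<omega>\<bar> > \<epsilon>} < \<epsilon>)"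

text \<open>\<open>Z\<close> is a version of the integral process \<open>\<integral>\<^sub>0\<^sup>t H(s-) dX(s)\<close>. For adapted cadlag \<open>H\<close> and a
  semimartingale \<open>X\<close>, the sums with integrand evaluated at the left end points converge to the
  integral of the left limits \<open>H(s-)\<close>.\<close>

definition has_stoch_integral :: "'a measure \<Rightarrow> 'a process \<Rightarrow> 'a process \<Rightarrow> 'a process \<Rightarrow> bool" where
  "has_stoch_integral M H X Z \<longleftrightarrow>
     (\<forall>t\<ge>0. H t \<in> borel_measurable M \<and> X t \<in> borel_measurable M \<and> Z t \<in> borel_measurable M) \<and>
     (AE \<omega> in M. cadlag (\<lambda>t. H t \<omega>) \<and> cadlag (\<lambda>t. X t \<omega>) \<and> cadlag (\<lambda>t. Z t \<omega>)) \<and>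
     (\<forall>t\<ge>0. mesh_limit_in_prob M t
        (\<lambda>n p \<omega>. \<Sum>k<n. H (p k) \<omega> * (X (p (Suc k)) \<omega> - X (p k) \<omega>)) (Z t))"

definition has_quadratic_variation :: "'a measure \<Rightarrow> 'a process \<Rightarrow> 'a process \<Rightarrow> bool" where
  "has_quadratic_variation M X Q \<longleftrightarrow>
     (\<forall>t\<ge>0. X t \<in> borel_measurable M \<and> Q t \<in> borel_measurable M) \<and>
     (AE \<omega> in M. cadlag (\<lambda>t. Q t \<omega>)) \<and>
     (\<forall>t\<ge>0. mesh_limit_in_prob M t
        (\<lambda>n p \<omega>. \<Sum>k<n. (X (p (Suc k)) \<omega> - X (p k) \<omega>)\<^sup>2) (Q t))"

text \<open>\<open>I w\<close> is the process \<open>I\<^sub>w\<close>. Iterated integrals are only determined up to indistinguishability,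
  whence a predicate: any choice of versions is allowed. The process \<open>I\<^sub>a\<close> of a letter and that of
  the one-letter word \<open>a\<close> coincide, as all \<open>I\<^sub>a\<close> vanish at time \<open>0\<close>.\<close>

definition iterated_integrals ::
  "'a measure \<Rightarrow> nat \<Rightarrow> nat \<Rightarrow> (nat \<Rightarrow> 'a process) \<Rightarrow> (nat \<Rightarrow> 'a process)
     \<Rightarrow> (letter list \<Rightarrow> 'a process) \<Rightarrow> bool" where
  "iterated_integrals M d l W J I \<longleftrightarrow>
     (\<forall>t\<ge>0. \<forall>\<omega>\<in>space M. I [] t \<omega> = 1) \<and>
     (\<forall>i\<le>l. \<forall>t\<ge>0. \<forall>\<omega>\<in>space M. I [(i, 1)] t \<omega> = driver d W J i t \<omega>) \<and>
     (\<forall>i\<in>{1..d}. has_quadratic_variation M (W i) (I [(i, 2)])) \<and>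
     (\<forall>i\<in>{d+1..l}. \<forall>m\<ge>2. AE \<omega> in M. \<forall>t\<ge>0.
        ((\<lambda>s. jump (J i) s \<omega> ^ m) has_sum I [(i, m)] t \<omega>) {0..t}) \<and>
     (\<forall>w\<in>words d l. \<forall>a\<in>alphabet d l. has_stoch_integral M (I w) (I [a]) (I (w @ [a])))"

definition mu :: "(letter list \<Rightarrow> 'a process) \<Rightarrow> word_poly \<Rightarrow> 'a process" where
  "mu I p t \<omega> = (\<Sum>w\<in>Poly_Mapping.keys p. Poly_Mapping.lookup p w * I w t \<omega>)"

section \<open>The flowmap\<close>

text \<open>\<open>Y y\<close> is the (adapted) solution of the SDE started at the point \<open>y\<close>.\<close>

definition sde_flow ::
  "'a measure \<Rightarrow> nat \<Rightarrow> nat \<Rightarrow> (nat \<Rightarrow> real ^ 'n \<Rightarrow> real ^ 'n) \<Rightarrow> (nat \<Rightarrow> 'a process)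
     \<Rightarrow> (nat \<Rightarrow> 'a process) \<Rightarrow> (real ^ 'n \<Rightarrow> real \<Rightarrow> 'a \<Rightarrow> real ^ 'n) \<Rightarrow> bool" where
  "sde_flow M d l V W J Y \<longleftrightarrow> (\<forall>y.
     (\<forall>t\<ge>0. Y y t \<in> borel_measurable (history M {1..l} (driver d W J) t)) \<and>
     (AE \<omega> in M. \<forall>j. cadlag (\<lambda>t. Y y t \<omega> $ j)) \<and>
     (\<exists>S :: nat \<Rightarrow> 'n \<Rightarrow> 'a process.
        (\<forall>i\<le>l. \<forall>j. has_stoch_integral M (\<lambda>s \<omega>. V i (Y y s \<omega>) $ j) (driver d W J i) (S i j)) \<and>
        (AE \<omega> in M. \<forall>t\<ge>0. \<forall>j. Y y t \<omega> $ j = y $ j + (\<Sum>i\<le>l. S i j t \<omega>))))"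

definition flowmap :: "(real ^ 'n \<Rightarrow> real \<Rightarrow> 'a \<Rightarrow> real ^ 'n) \<Rightarrow> real \<Rightarrow> 'a
    \<Rightarrow> (real ^ 'n \<Rightarrow> real) \<Rightarrow> real ^ 'n \<Rightarrow> real" where
  "flowmap Y t \<omega> f y = f (Y y t \<omega>)"

text \<open>A formal series graded by \<open>grade\<close>: \<open>S n t \<omega>\<close> is the component of degree \<open>n\<close> at time \<open>t\<close>, a
  differential operator with random coefficients.\<close>

type_synonym ('a, 'n) flow_series =
  "nat \<Rightarrow> real \<Rightarrow> 'a \<Rightarrow> (real ^ 'n \<Rightarrow> real) \<Rightarrow> real ^ 'n \<Rightarrow> real"

text \<open>The flowmap as a formal series, i.e. its stochastic Taylor expansion \<open>\<Sum>\<^sub>w I\<^sub>w D\<^sub>w\<close>.\<close>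

definition flow_series :: "nat \<Rightarrow> nat \<Rightarrow> (nat \<Rightarrow> real ^ 'n \<Rightarrow> real ^ 'n)
    \<Rightarrow> (letter list \<Rightarrow> 'a process) \<Rightarrow> ('a, 'n::finite) flow_series" where
  "flow_series d l V I n t \<omega> f y =
     (\<Sum>w | w \<in> words d l \<and> grade w = n. I w t \<omega> * word_op V w f y)"

text \<open>\<open>\<mu> \<otimes> \<mu>_bar\<close> applied to an endomorphism \<open>E\<close>, that is, to \<open>\<Sum>\<^sub>w E(w) \<otimes> w\<close>, the second factor
  being the barred word.\<close>

definition mu_tensor_mu_bar :: "nat \<Rightarrow> nat \<Rightarrow> (nat \<Rightarrow> real ^ 'n \<Rightarrow> real ^ 'n)
    \<Rightarrow> (letter list \<Rightarrow> 'a process) \<Rightarrow> (word_poly \<Rightarrow> word_poly) \<Rightarrow> ('a, 'n::finite) flow_series" where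
  "mu_tensor_mu_bar d l V I E n t \<omega> f y =
     (\<Sum>w | w \<in> words d l \<and> grade w = n. mu I (E (of_word w)) t \<omega> * mu_bar V (of_word w) f y)"

definition series_eq :: "'a measure \<Rightarrow> ('a, 'n::finite) flow_series \<Rightarrow> ('a, 'n) flow_series \<Rightarrow> bool" where
  "series_eq M S T \<longleftrightarrow>
     (\<forall>n. \<forall>t\<ge>0. \<forall>\<omega>\<in>space M. \<forall>f. real_analytic f \<longrightarrow> (\<forall>y. S n t \<omega> f y = T n t \<omega> f y))"

text \<open>The identity between flowmap and series read literally rather than formally. It need not hold
  even for the stochastic Taylor expansion itself.\<close>

definition converges_to_flowmap :: "'a measure \<Rightarrow> (real ^ 'n \<Rightarrow> real \<Rightarrow> 'a \<Rightarrow> real ^ 'n) \<Rightarrow> real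
    \<Rightarrow> ('a, 'n::finite) flow_series \<Rightarrow> bool" where
  "converges_to_flowmap M Y t S \<longleftrightarrow>
     (\<forall>f. real_analytic f \<longrightarrow>
        (\<forall>y. AE \<omega> in M. (\<lambda>n. S n t \<omega> f y) sums flowmap Y t \<omega> f y))"

end

theory Submission
  imports Defs
begin

text \<open>The process \<open>I\<close> and the vector fields \<open>V\<close> enter both sides of each identity only through
  linear maps applied to words, so the claim is one about the free algebra: the two tensors
  \<open>\<Sum> w \<otimes> w\<close> and \<open>\<Sum> dual0 d l w \<otimes> bar0 d l w\<close> are the same endomorphism.
  For the first one the identity with the flowmap is the stochastic Taylor expansion, term by term.

  For the second one, each letter has positive grade, and there are finitely many letters of each
  grade, so there are finitely many words of each grade. A nonzero bracket of several letters is a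
  single letter whose grade is the sum of theirs; hence \<open>bar0_letter d l a\<close> is \<open>a\<close> plus a
  combination of longer words of the same grade, and by multiplying out the same holds for every
  word (\<open>keys_bar0_minus_word\<close>). Thus the matrix of the new basis is unitriangular on each finite
  graded piece, when words are ordered by length, and so it is invertible.
  This yields existence and uniqueness of the dual basis (\<open>dual0_unique_existence\<close>) and shows that \<open>dual0 d l w\<close> is homogeneous of grade \<open>grade w\<close> (\<open>keys_dual0_subset\<close>).

  Duality says that the transpose of the matrix of the dual basis is a right inverse of the matrix
  of the new basis; what the representation of the flowmap needs is that it is a left inverse
  (\<open>dual0_bar0_resolution\<close>). As the matrix of the new basis is injective on each graded piece, the
  second follows from the first.\<close>

section \<open>Unitriangular systems of linear equations\<close>

text \<open>Back substitution: the equation of an index of least rank is the only one in which its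
  unknown occurs, so it can be solved last.\<close>

lemma unitriangular_solvable:
  fixes b :: "'i \<Rightarrow> 'i \<Rightarrow> real" and r :: "'i \<Rightarrow> nat"
  assumes "finite S"
    and "\<And>u. u \<in> S \<Longrightarrow> b u u = 1"
    and "\<And>u v. u \<in> S \<Longrightarrow> v \<in> S \<Longrightarrow> u \<noteq> v \<Longrightarrow> b u v \<noteq> 0 \<Longrightarrow> r u < r v"
  shows "\<exists>x. \<forall>u\<in>S. (\<Sum>v\<in>S. b u v * x v) = h u"
  using assms
proof (induction S rule: finite_ranking_induct[where f = "\<lambda>u. - int (r u)"])
  case empty
  then show ?case by simp
next
  case (insert u S)
  show ?case
  proof (cases "u \<in> S")
    case True
    then show ?thesis using insert by (simp add: insert_absorb)
  next
    case False
    obtain x where x: "\<And>w. w \<in> S \<Longrightarrow> (\<Sum>v\<in>S. b w v * x v) = h w"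
      using insert.IH insert.prems by blast
    define y where "y = x(u := h u - (\<Sum>v\<in>S. b u v * x v))"
    have y: "(\<Sum>v\<in>S. b w v * y v) = (\<Sum>v\<in>S. b w v * x v)" for w
      using False by (intro sum.cong) (auto simp: y_def)
    have column: "b w u = 0" if "w \<in> S" for w
      using that insert.prems(2)[of w u] insert.hyps(2)[of w] False by fastforce
    have "(\<Sum>v\<in>insert u S. b w v * y v) = h w" if "w \<in> insert u S" for w
    proof (cases "w = u")
      case True
      then show ?thesis
        using False insert.hyps(1) insert.prems(1)[of u] by (simp add: y) (simp add: y_def)
    next
      case False
      then show ?thesis
        using that \<open>u \<notin> S\<close> insert.hyps(1) column[of w] by (simp add: y x)
    qed
    then show ?thesis by blast
  qed
qed

text \<open>If two solutions differ, the equation at an index of largest rank where they do reduces to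
  the equality of their values at that index.\<close>

lemma unitriangular_solution_unique:
  fixes b :: "'i \<Rightarrow> 'i \<Rightarrow> real" and r :: "'i \<Rightarrow> nat"
  assumes "finite S"
    and diagonal: "\<And>u. u \<in> S \<Longrightarrow> b u u = 1"
    and triangular: "\<And>u v. u \<in> S \<Longrightarrow> v \<in> S \<Longrightarrow> u \<noteq> v \<Longrightarrow> b u v \<noteq> 0 \<Longrightarrow> r u < r v"
    and eq: "\<And>u. u \<in> S \<Longrightarrow> (\<Sum>v\<in>S. b u v * x v) = (\<Sum>v\<in>S. b u v * y v)"
    and "u \<in> S"
  shows "x u = y u"
proof (rule ccontr)
  let ?T = "{u \<in> S. x u \<noteq> y u}"
  assume "x u \<noteq> y u"
  then have T: "finite ?T" "?T \<noteq> {}" using assms(1,5) by auto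
  define m where "m = Max (r ` ?T)"
  have "m \<in> r ` ?T" unfolding m_def using T by (intro Max_in) auto
  then obtain w where w: "w \<in> S" "x w \<noteq> y w" "r w = m" by auto
  have max: "r v \<le> r w" if "v \<in> S" "x v \<noteq> y v" for v
    unfolding w(3) m_def using that T by (intro Max_ge) auto
  have "0 = (\<Sum>v\<in>S. b w v * (x v - y v))"
    using eq[OF w(1)] by (simp add: right_diff_distrib sum_subtractf)
  also have "\<dots> = (\<Sum>v\<in>S. if v = w then x v - y v else 0)"
  proof (intro sum.cong refl)
    fix v assume v: "v \<in> S"
    show "b w v * (x v - y v) = (if v = w then x v - y v else 0)"
      using diagonal[OF w(1)] triangular[OF w(1) v] max[OF v]
      by (cases "v = w"; cases "x v = y v"; cases "b w v = 0") auto
  qed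
  also have "\<dots> = x w - y w" using w(1) assms(1) by (simp add: sum.delta)
  finally show False using w(2) by simp
qed

section \<open>Linear maps given on words\<close>

lemma lookup_scale [simp]:
  "Poly_Mapping.lookup (scale c p) w = c * Poly_Mapping.lookup p w"
  unfolding scale_def by (simp add: Poly_Mapping.map.rep_eq when_def)

lemma keys_scale_subset: "Poly_Mapping.keys (scale c p) \<subseteq> Poly_Mapping.keys p"
  by (auto simp: in_keys_iff)

lemma keys_of_word [simp]: "Poly_Mapping.keys (of_word w) = {w}"
  by (simp add: of_word_def)

lemma lookup_of_word:
  "Poly_Mapping.lookup (of_word w) v = (if v = w then 1 else 0)"
  by (simp add: of_word_def lookup_single when_def)

lemma of_word_mult: "of_word u * of_word v = of_word (u @ v)"
  by (simp add: of_word_def mult_single plus_list_def)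

lemma keys_mult_words:
  assumes "w \<in> Poly_Mapping.keys ((p :: word_poly) * q)"
  obtains u v where "w = u @ v" "u \<in> Poly_Mapping.keys p" "v \<in> Poly_Mapping.keys q"
  using assms keys_mult[of p q] unfolding plus_list_def by blast

lemma sum_keys_superset:
  assumes "finite S" "Poly_Mapping.keys p \<subseteq> S"
  shows "(\<Sum>w\<in>Poly_Mapping.keys p. Poly_Mapping.lookup p w * g w)
       = (\<Sum>w\<in>S. Poly_Mapping.lookup p w * (g w :: real))"
  using assms by (intro sum.mono_neutral_left) (auto simp: in_keys_iff)

lemma mu_of_word [simp]: "mu I (of_word w) t \<omega> = I w t \<omega>"
  by (simp add: mu_def lookup_of_word)

lemma mu_bar_of_word [simp]: "mu_bar V (of_word w) f y = word_op V w f y"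
  by (simp add: mu_bar_def lookup_of_word)

lemma pairing_sum:
  assumes "finite S" "Poly_Mapping.keys q \<subseteq> S"
  shows "pairing p q = (\<Sum>w\<in>S. Poly_Mapping.lookup q w * Poly_Mapping.lookup p w)"
proof -
  have "pairing p q
      = (\<Sum>w\<in>S \<union> Poly_Mapping.keys p. Poly_Mapping.lookup p w * Poly_Mapping.lookup q w)"
    unfolding pairing_def using assms by (intro sum_keys_superset) auto
  also have "\<dots> = (\<Sum>w\<in>S. Poly_Mapping.lookup p w * Poly_Mapping.lookup q w)"
    using assms by (intro sum.mono_neutral_right) (auto simp: in_keys_iff)
  finally show ?thesis by (simp add: mult.commute)
qed

lemma pairing_of_word [simp]: "pairing p (of_word w) = Poly_Mapping.lookup p w"
  by (subst pairing_sum[of "{w}"]) (auto simp: lookup_of_word)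

lemma pairing_of_word_left: "pairing (of_word w) q = Poly_Mapping.lookup q w"
  by (simp add: pairing_def lookup_of_word)

lemma Id_tensor_eq_self:
  assumes "z \<in> word_space d l"
  shows "Id_tensor d l z = z"
proof (rule poly_mapping_eqI)
  fix v
  have "{w. w \<in> words d l \<and> pairing z (of_word w) \<noteq> 0} = Poly_Mapping.keys z"
    using assms by (auto simp: word_space_def in_keys_iff)
  then show "Poly_Mapping.lookup (Id_tensor d l z) v = Poly_Mapping.lookup z v"
    by (simp add: Id_tensor_def tensor_sum_def lookup_sum lookup_of_word in_keys_iff
        if_distrib[of "(*) _"] cong: if_cong)
qed

section \<open>The grading\<close>

abbreviation (input) graded_words :: "nat \<Rightarrow> nat \<Rightarrow> nat \<Rightarrow> letter list set" where
  "graded_words d l n \<equiv> {w. w \<in> words d l \<and> grade w = n}"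

lemma grade_append: "grade (u @ v) = grade u + grade v"
  by (simp add: grade_def)

lemma grade_Cons: "grade (a # v) = letter_grade a + grade v"
  by (simp add: grade_def)

lemma letter_grade_pos: "a \<in> alphabet d l \<Longrightarrow> 1 \<le> letter_grade a"
  by (auto simp: alphabet_def)

lemma length_le_grade: "w \<in> words d l \<Longrightarrow> length w \<le> grade w"
proof (induction w)
  case (Cons a w)
  then show ?case using letter_grade_pos[of a d l] by (simp add: grade_Cons)
qed simp

lemma letter_grade_le_grade: "a \<in> set w \<Longrightarrow> letter_grade a \<le> grade w"
  by (auto simp: grade_def intro: member_le_sum_list)

lemma finite_letters_of_bounded_grade: "finite {a \<in> alphabet d l. letter_grade a \<le> n}"
proof (rule finite_subset)
  \<comment> \<open>The first component runs up to \<open>l + d\<close> because there are letters \<open>i\<^sup>(\<^sup>2\<^sup>)\<close> with \<open>l < i\<close> if \<open>l < d\<close>.\<close>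
  show "{a \<in> alphabet d l. letter_grade a \<le> n} \<subseteq> {..l + d} \<times> {..n}"
    by (auto simp: alphabet_def split: if_splits)
qed simp

lemma finite_graded_words [simp]: "finite (graded_words d l n)"
proof (rule finite_subset)
  show "graded_words d l n
      \<subseteq> {w. set w \<subseteq> {a \<in> alphabet d l. letter_grade a \<le> n} \<and> length w \<le> n}"
    using length_le_grade letter_grade_le_grade by fastforce
qed (intro finite_lists_length_le finite_letters_of_bounded_grade)

lemma letter_grade_bracket:
  "bracket d a b = Some c \<Longrightarrow> letter_grade c = letter_grade a + letter_grade b"
  by (cases a; cases b) (auto split: if_splits)

lemma grade_brackets: "brackets d w = Some a \<Longrightarrow> grade w = letter_grade a"
proof (induction d w arbitrary: a rule: brackets.induct)
  case (3 d a b w)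
  then show ?case
    by (auto simp: grade_Cons bind_eq_Some_conv dest: letter_grade_bracket)
qed (auto simp: grade_def)

section \<open>The new basis is unitriangular\<close>

text \<open>The words whose bracket is \<open>a\<close> are \<open>a\<close> itself, with coefficient \<open>1\<close>, and words of at least
  two letters.\<close>

lemma keys_bar0_letter_minus_letter:
  assumes "a \<in> alphabet d l"
  shows "Poly_Mapping.keys (bar0_letter d l a - of_word [a])
       \<subseteq> {w \<in> words d l. grade w = letter_grade a \<and> 1 < length w}"
proof -
  define B where "B = {w. w \<in> words d l \<and> brackets d w = Some a}"
  define c where "c w = (-1) ^ (length w - 1) / real (length w)" for w :: "letter list"
  have "finite B"
    by (rule finite_subset[OF _ finite_graded_words[of d l "letter_grade a"]])
      (auto simp: B_def grade_brackets)
  moreover have "[a] \<in> B" using assms by (simp add: B_def)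
  ultimately have "bar0_letter d l a
      = scale (c [a]) (of_word [a]) + (\<Sum>w\<in>B - {[a]}. scale (c w) (of_word w))"
    unfolding bar0_letter_def B_def[symmetric] c_def[symmetric] by (intro sum.remove)
  moreover have "scale (c [a]) (of_word [a]) = of_word [a]"
    by (rule poly_mapping_eqI) (simp add: c_def)
  ultimately have "bar0_letter d l a - of_word [a] = (\<Sum>w\<in>B - {[a]}. scale (c w) (of_word w))"
    by simp
  then have "Poly_Mapping.keys (bar0_letter d l a - of_word [a])
      \<subseteq> (\<Union>w\<in>B - {[a]}. Poly_Mapping.keys (scale (c w) (of_word w)))"
    by (simp only: keys_sum)
  also have "\<dots> \<subseteq> B - {[a]}"
    using keys_scale_subset by fastforce
  also have "\<dots> \<subseteq> {w \<in> words d l. grade w = letter_grade a \<and> 1 < length w}"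
  proof
    fix w assume w: "w \<in> B - {[a]}"
    then have "w \<noteq> []" "\<not> (\<exists>b. w = [b])" by (auto simp: B_def)
    then have "1 < length w" by (cases w rule: remdups_adj.cases) auto
    with w show "w \<in> {w \<in> words d l. grade w = letter_grade a \<and> 1 < length w}"
      by (auto simp: B_def dest: grade_brackets)
  qed
  finally show ?thesis .
qed

text \<open>In a product of elements of the form leading word plus longer words, the leading words
  concatenate, and each remaining product of terms is longer.\<close>

lemma keys_bar0_minus_word:
  assumes "w \<in> words d l"
  shows "Poly_Mapping.keys (bar0 d l w - of_word w)
       \<subseteq> {u \<in> words d l. grade u = grade w \<and> length w < length u}"
  using assms
proof (induction w rule: list.induct)
  case Nil
  have "of_word [] = 1"
    unfolding of_word_def by (metis single_one zero_list_def)
  then show ?case by (simp add: bar0_def)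
next
  case (Cons a w)
  define R where "R = bar0_letter d l a - of_word [a]"
  define Q where "Q = bar0 d l w - of_word w"
  have a: "a \<in> alphabet d l" and w: "w \<in> words d l" using Cons.prems by auto
  have R: "u \<in> words d l \<and> grade u = letter_grade a \<and> 1 < length u"
    if "u \<in> Poly_Mapping.keys R" for u
    using that keys_bar0_letter_minus_letter[OF a] unfolding R_def by blast
  have Q: "u \<in> words d l \<and> grade u = grade w \<and> length w < length u"
    if "u \<in> Poly_Mapping.keys Q" for u
    using that Cons.IH[OF w] unfolding Q_def by blast
  have bar0_w: "u \<in> words d l \<and> grade u = grade w \<and> length w \<le> length u"
    if "u \<in> Poly_Mapping.keys (bar0 d l w)" for u
  proof -
    have "bar0 d l w = Q + of_word w" by (simp add: Q_def)
    then show ?thesis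
      using that keys_add[of Q "of_word w"] Q[of u] w by auto
  qed
  have "of_word (a # w) = of_word [a] * of_word w" by (simp add: of_word_mult)
  then have "bar0 d l (a # w) - of_word (a # w) = R * bar0 d l w + of_word [a] * Q"
    by (simp add: bar0_def R_def Q_def algebra_simps)
  moreover have "u \<in> words d l \<and> grade u = grade (a # w) \<and> length (a # w) < length u"
    if "u \<in> Poly_Mapping.keys (R * bar0 d l w)" for u
    using that
  proof (rule keys_mult_words)
    fix u1 u2
    assume "u = u1 @ u2" "u1 \<in> Poly_Mapping.keys R" "u2 \<in> Poly_Mapping.keys (bar0 d l w)"
    then show ?thesis
      using R[of u1] bar0_w[of u2] by (auto simp: grade_append grade_Cons)
  qed
  moreover have "u \<in> words d l \<and> grade u = grade (a # w) \<and> length (a # w) < length u"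
    if "u \<in> Poly_Mapping.keys (of_word [a] * Q)" for u
    using that
  proof (rule keys_mult_words)
    fix u1 u2
    assume "u = u1 @ u2" "u1 \<in> Poly_Mapping.keys (of_word [a])" "u2 \<in> Poly_Mapping.keys Q"
    then show ?thesis
      using Q[of u2] a by (auto simp: grade_Cons)
  qed
  ultimately show ?case
    using keys_add[of "R * bar0 d l w" "of_word [a] * Q"] by auto
qed

lemma lookup_bar0_self:
  assumes "w \<in> words d l"
  shows "Poly_Mapping.lookup (bar0 d l w) w = 1"
proof -
  have "w \<notin> Poly_Mapping.keys (bar0 d l w - of_word w)"
    using keys_bar0_minus_word[OF assms] by blast
  then show ?thesis by (simp add: in_keys_iff lookup_minus lookup_of_word)
qed

lemma lookup_bar0_nonzero:
  assumes "w \<in> words d l" "u \<noteq> w" "Poly_Mapping.lookup (bar0 d l w) u \<noteq> 0"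
  shows "u \<in> words d l \<and> grade u = grade w \<and> length w < length u"
proof -
  have "u \<in> Poly_Mapping.keys (bar0 d l w - of_word w)"
    using assms by (simp add: in_keys_iff lookup_minus lookup_of_word)
  then show ?thesis using keys_bar0_minus_word[OF assms(1)] by blast
qed

lemma keys_bar0_subset:
  "w \<in> words d l \<Longrightarrow> Poly_Mapping.keys (bar0 d l w) \<subseteq> graded_words d l (grade w)"
  using lookup_bar0_nonzero[of w d l] by (fastforce simp only: in_keys_iff mem_Collect_eq)

lemma pairing_bar0:
  "w \<in> words d l \<Longrightarrow> pairing p (bar0 d l w)
     = (\<Sum>v\<in>graded_words d l (grade w).
          Poly_Mapping.lookup (bar0 d l w) v * Poly_Mapping.lookup p v)"
  by (intro pairing_sum keys_bar0_subset) auto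

lemma bar0_system_solvable:
  "\<exists>x. \<forall>u\<in>graded_words d l n.
     (\<Sum>v\<in>graded_words d l n. Poly_Mapping.lookup (bar0 d l u) v * x v) = h u"
  by (rule unitriangular_solvable[where r = length])
    (auto simp: lookup_bar0_self dest!: lookup_bar0_nonzero[rotated 2])

lemma bar0_system_solution_unique:
  assumes "\<And>u. u \<in> graded_words d l n \<Longrightarrow>
      (\<Sum>v\<in>graded_words d l n. Poly_Mapping.lookup (bar0 d l u) v * x v)
    = (\<Sum>v\<in>graded_words d l n. Poly_Mapping.lookup (bar0 d l u) v * y v)"
    and "u \<in> graded_words d l n"
  shows "x u = y u"
  using _ _ _ assms
  by (rule unitriangular_solution_unique[where r = length])
    (auto simp: lookup_bar0_self dest!: lookup_bar0_nonzero[rotated 2])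

section \<open>The dual basis\<close>

lemma eq_if_pairings_with_bar0_eq:
  assumes "p \<in> word_space d l" "q \<in> word_space d l"
    and "\<And>u. u \<in> words d l \<Longrightarrow> pairing p (bar0 d l u) = pairing q (bar0 d l u)"
  shows "p = q"
proof (rule poly_mapping_eqI)
  fix v
  show "Poly_Mapping.lookup p v = Poly_Mapping.lookup q v"
  proof (cases "v \<in> words d l")
    case True
    show ?thesis
    proof (rule bar0_system_solution_unique)
      fix u assume "u \<in> graded_words d l (grade v)"
      then show "(\<Sum>v\<in>graded_words d l (grade v).
            Poly_Mapping.lookup (bar0 d l u) v * Poly_Mapping.lookup p v)
        = (\<Sum>v\<in>graded_words d l (grade v).
            Poly_Mapping.lookup (bar0 d l u) v * Poly_Mapping.lookup q v)"
        using assms(3)[of u] pairing_bar0[of u d l] by auto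
    qed (use True in simp)
  next
    case False
    then have "v \<notin> Poly_Mapping.keys p" "v \<notin> Poly_Mapping.keys q"
      using assms(1,2) by (auto simp: word_space_def)
    then show ?thesis by (simp add: in_keys_iff)
  qed
qed

text \<open>The conditions for different grades involve disjoint sets of coefficients. So one solves the
  system in the grade of \<open>w\<close> and puts \<open>0\<close> in all others.\<close>

lemma homogeneous_dual_exists:
  assumes "w \<in> words d l"
  shows "\<exists>p. Poly_Mapping.keys p \<subseteq> graded_words d l (grade w) \<and>
    (\<forall>u\<in>words d l. pairing p (bar0 d l u) = (if u = w then 1 else 0))"
proof -
  let ?S = "graded_words d l (grade w)"
  obtain x where x: "\<And>u. u \<in> ?S \<Longrightarrow>
      (\<Sum>v\<in>?S. Poly_Mapping.lookup (bar0 d l u) v * x v) = (if u = w then 1 else 0)"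
    using bar0_system_solvable[of d l "grade w" "\<lambda>u. if u = w then 1 else 0"] by blast
  define p where "p = Poly_Mapping.Abs_poly_mapping (\<lambda>v. if v \<in> ?S then x v else 0)"
  have "finite {v. (if v \<in> ?S then x v else 0) \<noteq> 0}"
    by (rule finite_subset[OF _ finite_graded_words[of d l "grade w"]]) auto
  then have p: "Poly_Mapping.lookup p = (\<lambda>v. if v \<in> ?S then x v else 0)"
    unfolding p_def by (rule lookup_Abs_poly_mapping)
  have "pairing p (bar0 d l u) = (if u = w then 1 else 0)" if u: "u \<in> words d l" for u
  proof (cases "grade u = grade w")
    case True
    have "pairing p (bar0 d l u) = (\<Sum>v\<in>?S. Poly_Mapping.lookup (bar0 d l u) v * x v)"
      using u True by (subst pairing_bar0) (auto simp: p intro!: sum.cong)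
    then show ?thesis using x u True by simp
  next
    case False
    then show ?thesis
      using u by (subst pairing_bar0) (auto simp: p intro!: sum.neutral)
  qed
  moreover have "Poly_Mapping.keys p \<subseteq> ?S" by (auto simp: in_keys_iff p split: if_splits)
  ultimately show ?thesis by blast
qed

lemma dual0_unique_existence:
  assumes "w \<in> words d l"
  shows "\<exists>!p. p \<in> word_space d l \<and>
    (\<forall>u\<in>words d l. pairing p (bar0 d l u) = (if u = w then 1 else 0))"
proof -
  obtain p where "Poly_Mapping.keys p \<subseteq> graded_words d l (grade w)"
    and p: "\<forall>u\<in>words d l. pairing p (bar0 d l u) = (if u = w then 1 else 0)"
    using homogeneous_dual_exists[OF assms] by blast
  then have "p \<in> word_space d l" unfolding word_space_def by blast
  with p show ?thesis
    by (intro ex1I[of _ p] conjI) (blast, blast, rule eq_if_pairings_with_bar0_eq[of _ d l], simp_all)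
qed

lemma
  assumes "w \<in> words d l"
  shows keys_dual0_subset:
      "Poly_Mapping.keys (dual0 d l w) \<subseteq> graded_words d l (grade w)"
    and pairing_dual0_bar0:
      "u \<in> words d l \<Longrightarrow> pairing (dual0 d l w) (bar0 d l u) = (if u = w then 1 else 0)"
proof -
  obtain p where keys: "Poly_Mapping.keys p \<subseteq> graded_words d l (grade w)"
    and p: "\<forall>u\<in>words d l. pairing p (bar0 d l u) = (if u = w then 1 else 0)"
    using homogeneous_dual_exists[OF assms] by blast
  have "dual0 d l w = p"
    unfolding dual0_def
    by (rule the1_equality[OF dual0_unique_existence[OF assms]])
      (use keys p in \<open>auto simp: word_space_def\<close>)
  then show "Poly_Mapping.keys (dual0 d l w) \<subseteq> graded_words d l (grade w)"
    and "u \<in> words d l \<Longrightarrow> pairing (dual0 d l w) (bar0 d l u) = (if u = w then 1 else 0)"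
    using keys p by auto
qed

text \<open>Let \<open>b\<close> and \<open>p\<close> be the matrices whose rows are the coefficients of \<open>bar0 d l w\<close> and of
  \<open>dual0 d l w\<close>, for \<open>w\<close> of grade \<open>n\<close>. Duality says that \<open>b p\<^sup>T = 1\<close>; the claim is that
  \<open>p\<^sup>T b = 1\<close>. This follows by cancelling \<open>b\<close>, which is injective, from \<open>b (p\<^sup>T b) = b\<close>.\<close>

lemma dual0_bar0_resolution:
  assumes "v \<in> graded_words d l n" "v' \<in> graded_words d l n"
  shows "(\<Sum>w\<in>graded_words d l n.
      Poly_Mapping.lookup (dual0 d l w) v * Poly_Mapping.lookup (bar0 d l w) v')
    = (if v = v' then 1 else 0)"
proof (rule bar0_system_solution_unique[where u = v and n = n])
  let ?S = "graded_words d l n"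
  let ?b = "\<lambda>w. Poly_Mapping.lookup (bar0 d l w)"
  let ?p = "\<lambda>w. Poly_Mapping.lookup (dual0 d l w)"
  fix u assume u: "u \<in> ?S"
  have "(\<Sum>v\<in>?S. ?b u v * (\<Sum>w\<in>?S. ?p w v * ?b w v'))
      = (\<Sum>w\<in>?S. (\<Sum>v\<in>?S. ?b u v * ?p w v) * ?b w v')"
    unfolding sum_distrib_left sum_distrib_right mult.assoc by (rule sum.swap)
  also have "\<dots> = (\<Sum>w\<in>?S. if w = u then ?b w v' else 0)"
  proof (rule sum.cong)
    fix w assume "w \<in> ?S"
    then have "(\<Sum>v\<in>?S. ?b u v * ?p w v) = (if u = w then 1 else 0)"
      using u pairing_bar0[of u d l "dual0 d l w"] pairing_dual0_bar0[of w d l u] by auto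
    then show "(\<Sum>v\<in>?S. ?b u v * ?p w v) * ?b w v' = (if w = u then ?b w v' else 0)"
      by auto
  qed simp
  also have "\<dots> = ?b u v'" using u by simp
  also have "\<dots> = (\<Sum>v\<in>?S. if v = v' then ?b u v else 0)" using assms(2) by simp
  also have "\<dots> = (\<Sum>v\<in>?S. ?b u v * (if v = v' then 1 else 0))"
    by (intro sum.cong) auto
  finally show "(\<Sum>v\<in>?S. ?b u v * (\<Sum>w\<in>?S. ?p w v * ?b w v'))
      = (\<Sum>v\<in>?S. ?b u v * (if v = v' then 1 else 0))" .
qed (use assms in simp)

lemma tensor_sum_dual0_bar0_of_word:
  assumes "v \<in> words d l"
  shows "tensor_sum d l (dual0 d l) (bar0 d l) (of_word v) = of_word v"
proof (rule poly_mapping_eqI)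
  fix v'
  let ?S = "graded_words d l (grade v)"
  let ?b = "\<lambda>w. Poly_Mapping.lookup (bar0 d l w)"
  let ?p = "\<lambda>w. Poly_Mapping.lookup (dual0 d l w)"
  have same_grade: "grade w = grade v" if "w \<in> words d l" "?b w v \<noteq> 0" for w
    using that lookup_bar0_nonzero[of w d l v] by metis
  have "Poly_Mapping.lookup (tensor_sum d l (dual0 d l) (bar0 d l) (of_word v)) v'
      = (\<Sum>w | w \<in> words d l \<and> ?b w v \<noteq> 0. ?b w v * ?p w v')"
    by (simp add: tensor_sum_def lookup_sum pairing_of_word_left)
  also have "\<dots> = (\<Sum>w\<in>?S. ?p w v' * ?b w v)"
    using same_grade by (intro sum.mono_neutral_cong_left) auto
  also have "\<dots> = (if v' = v then 1 else 0)"
  proof (cases "v' \<in> ?S")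
    case True
    then show ?thesis using dual0_bar0_resolution[of v' d l "grade v" v] assms by simp
  next
    case False
    then have "?p w v' = 0" if "w \<in> ?S" for w
      using that keys_dual0_subset[of w d l] by (auto simp: in_keys_iff)
    moreover have "v' \<noteq> v" using False assms by auto
    ultimately show ?thesis by simp
  qed
  finally show "Poly_Mapping.lookup (tensor_sum d l (dual0 d l) (bar0 d l) (of_word v)) v'
      = Poly_Mapping.lookup (of_word v) v'"
    by (simp add: lookup_of_word)
qed

section \<open>The flowmap in the two pairs of bases\<close>

lemma mu_tensor_mu_bar_eq_flow_series:
  assumes "\<And>w. w \<in> words d l \<Longrightarrow> E (of_word w) = of_word w"
  shows "mu_tensor_mu_bar d l V I E = flow_series d l V I"
  by (intro ext) (simp add: mu_tensor_mu_bar_def flow_series_def assms)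

text \<open>Expanding \<open>dual0 d l w\<close> and \<open>bar0 d l w\<close> in words and summing over \<open>w\<close> first leaves the diagonal terms
  only.\<close>

lemma flow_series_dual0_bar0:
  "flow_series d l V I n t \<omega> f y
     = (\<Sum>w\<in>graded_words d l n. mu I (dual0 d l w) t \<omega> * mu_bar V (bar0 d l w) f y)"
proof -
  let ?S = "graded_words d l n"
  let ?b = "\<lambda>w. Poly_Mapping.lookup (bar0 d l w)"
  let ?p = "\<lambda>w. Poly_Mapping.lookup (dual0 d l w)"
  let ?I = "\<lambda>v. I v t \<omega>"
  let ?D = "\<lambda>v. word_op V v f y"
  have mu: "mu I (dual0 d l w) t \<omega> = (\<Sum>v\<in>?S. ?p w v * ?I v)" if "w \<in> ?S" for w
    unfolding mu_def using that keys_dual0_subset[of w d l] by (intro sum_keys_superset) auto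
  have mu_bar: "mu_bar V (bar0 d l w) f y = (\<Sum>v'\<in>?S. ?b w v' * ?D v')" if "w \<in> ?S" for w
    unfolding mu_bar_def using that keys_bar0_subset[of w d l] by (intro sum_keys_superset) auto
  have "(\<Sum>w\<in>?S. mu I (dual0 d l w) t \<omega> * mu_bar V (bar0 d l w) f y)
      = (\<Sum>w\<in>?S. \<Sum>v\<in>?S. \<Sum>v'\<in>?S. ?I v * ?D v' * (?p w v * ?b w v'))"
    by (intro sum.cong) (simp_all add: mu mu_bar sum_product mult_ac)
  also have "\<dots> = (\<Sum>v\<in>?S. \<Sum>v'\<in>?S. \<Sum>w\<in>?S. ?I v * ?D v' * (?p w v * ?b w v'))"
    by (subst sum.swap) (intro sum.cong refl sum.swap)
  also have "\<dots> = (\<Sum>v\<in>?S. \<Sum>v'\<in>?S. if v' = v then ?I v * ?D v' else 0)"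
  proof (intro sum.cong refl)
    fix v v' assume "v \<in> ?S" "v' \<in> ?S"
    then show "(\<Sum>w\<in>?S. ?I v * ?D v' * (?p w v * ?b w v')) = (if v' = v then ?I v * ?D v' else 0)"
      unfolding sum_distrib_left[symmetric] by (subst dual0_bar0_resolution) auto
  qed
  also have "\<dots> = flow_series d l V I n t \<omega> f y"
    by (simp add: flow_series_def)
  finally show ?thesis by simp
qed

theorem proposition6:
  fixes M :: "'a measure"
    and d l :: nat
    and V :: "nat \<Rightarrow> real ^ 'n \<Rightarrow> real ^ 'n"
    and W J :: "nat \<Rightarrow> 'a process"
    and I :: "letter list \<Rightarrow> 'a process"
    and Y :: "real ^ 'n \<Rightarrow> real \<Rightarrow> 'a \<Rightarrow> real ^ 'n"
  assumes "prob_space M"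
    and "d \<le> l"
    and "\<And>i. i \<le> l \<Longrightarrow> real_analytic (V i)"
    and "driving_processes M d l W J"
    and "iterated_integrals M d l W J I"
    and "sde_flow M d l V W J Y"
  shows "(\<forall>z\<in>word_space d l. Id_tensor d l z = z)
    \<and> series_eq M (flow_series d l V I) (mu_tensor_mu_bar d l V I (Id_tensor d l))
    \<and> series_eq M (mu_tensor_mu_bar d l V I (Id_tensor d l))
        (mu_tensor_mu_bar d l V I (tensor_sum d l (dual0 d l) (bar0 d l)))
    \<and> series_eq M (flow_series d l V I)
        (\<lambda>n t \<omega> f y. \<Sum>w | w \<in> words d l \<and> grade w = n.
           mu I (dual0 d l w) t \<omega> * mu_bar V (bar0 d l w) f y)
    \<and> (\<forall>t\<ge>0. converges_to_flowmap M Y t (flow_series d l V I) \<longrightarrow>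
        converges_to_flowmap M Y t (mu_tensor_mu_bar d l V I (Id_tensor d l)) \<and>
        converges_to_flowmap M Y t
          (mu_tensor_mu_bar d l V I (tensor_sum d l (dual0 d l) (bar0 d l))))"
proof -
  have Id: "mu_tensor_mu_bar d l V I (Id_tensor d l) = flow_series d l V I"
    by (rule mu_tensor_mu_bar_eq_flow_series) (simp add: Id_tensor_eq_self word_space_def)
  have new: "mu_tensor_mu_bar d l V I (tensor_sum d l (dual0 d l) (bar0 d l))
      = flow_series d l V I"
    by (rule mu_tensor_mu_bar_eq_flow_series) (rule tensor_sum_dual0_bar0_of_word)
  have dual: "(\<lambda>n t \<omega> f y. \<Sum>w\<in>graded_words d l n.
        mu I (dual0 d l w) t \<omega> * mu_bar V (bar0 d l w) f y) = flow_series d l V I"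
    by (intro ext) (rule flow_series_dual0_bar0[symmetric])
  show ?thesis
    unfolding Id new dual series_eq_def using Id_tensor_eq_self by blast
qed

end
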